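(* Let $d \geq 2$ and let $B \subset Mat_d^0(\mathbb{Z})$ be a Bohr-zero non-periodic set. Then for every matrix $C \in Mat_d^0(\mathbb{Z})$ there exist a matrix $A \in B$ and a matrix $g \in SL_d(\mathbb{Z})$ such that $C = g^{-1}Ag$.
   Context: $Mat_d^0(\mathbb{Z})$ denotes the additive group of $d\times d$ integer matrices with trace zero, and $SL_d(\mathbb{Z})$ the group of $d\times d$ integer matrices of determinant one. $\mathbb{T}^n=\mathbb{R}^n/\mathbb{Z}^n$. For a countable abelian group $G$, a set $B\subset G$ is a non-periodic Bohr set if there exist $n\ge 1$, a homomorphism $\tau:G\to\mathbb{T}^n$ with $\overline{\tau(G)}=\mathbb{T}^n$, and an open set $U\subset\mathbb{T}^n$ with $B=\tau^{-1}(U)$; it is Bohr-zero if moreover $U$ contains the zero element of $\mathbb{T}^n$. *)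

theory Defs
  imports "HOL-Analysis.Analysis"
begin

definition trace_zero_mats :: "(int^'d^'d) set" where
  "trace_zero_mats = {A. trace A = 0}"

text \<open>The n-torus T^n = R^n/Z^n, realised (as a topological group) as the
  product of n unit circles in complex^'n, with componentwise multiplication;
  its zero element is the all-ones vector.\<close>
definition torus :: "(complex^'n) set" where
  "torus = {z. \<forall>i. norm (z $ i) = 1}"

definition torus_unit :: "complex^'n" where
  "torus_unit = (\<chi> i. 1)"

definition dense_torus_hom :: "(int^'d^'d \<Rightarrow> complex^'n) \<Rightarrow> bool" where
  "dense_torus_hom \<tau> \<longleftrightarrow>
     (\<forall>A\<in>trace_zero_mats. \<tau> A \<in> torus) \<and>
     (\<forall>A\<in>trace_zero_mats. \<forall>B\<in>trace_zero_mats. \<forall>i. \<tau> (A + B) $ i = \<tau> A $ i * \<tau> B $ i) \<and>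
     closure (\<tau> ` trace_zero_mats) = torus"

definition bohr_zero_witness ::
    "(int^'d^'d \<Rightarrow> complex^'n) \<Rightarrow> (complex^'n) set \<Rightarrow> (int^'d^'d) set \<Rightarrow> bool" where
  "bohr_zero_witness \<tau> U B \<longleftrightarrow>
     dense_torus_hom \<tau> \<and> openin (top_of_set torus) U \<and> torus_unit \<in> U \<and>
     B = {A \<in> trace_zero_mats. \<tau> A \<in> U}"

end

theory Submission
  imports Defs "HOL-Computational_Algebra.Polynomial" "HOL-Real_Asymp.Real_Asymp"
begin

text \<open>
  For \<open>C \<noteq> 0\<close> conjugate \<open>C\<close> by the transvections \<open>1 + 2 t X\<close> with \<open>X = v w\<^sup>T\<close> and \<open>w \<bullet> v = 0\<close>.
  Since \<open>X C X = (w\<^sup>T C v) X\<close>, the conjugates are \<open>C + 2 t [X, C] - 4 t\<^sup>2 (w\<^sup>T C v) X\<close>, and a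
  character of trace-zero matrices evaluates on them to \<open>e(\<alpha> + \<beta> t + \<gamma> t\<^sup>2)\<close>, where \<open>\<gamma>\<close> is
  irrational as soon as \<open>w\<^sup>T C v \<noteq> 0\<close> and the character has infinite order at \<open>X\<close>. By
  van der Corput's argument the averages over \<open>t\<close> then vanish. Only finitely many characters of
  the torus matter for detecting \<open>U\<close> (those in the Fourier expansion of the kernel
  \<open>\<Prod>\<^sub>i ((1 + z\<^sub>i)\<^sup>2 / (4 z\<^sub>i))\<^sup>N\<close>), the density of \<open>\<tau>\<close> makes each nontrivial one of infinite order,
  and one \<open>X\<close> can be found that serves all of them: on a line in parameter space the
  relevant form is a polynomial in \<open>t\<close>, which takes rational values only finitely often
  unless it does so at every integer.
\<close>

section \<open>Simultaneous irrationality\<close>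

text \<open>Induction on the degree: subtracting the rational value at some integer
  \<open>t0\<close> and dividing by \<open>x - t0\<close> leaves a quotient of smaller degree that
  is still rational at infinitely many integers. Hence one irrational value at an integer leaves
  room for only finitely many rational ones.\<close>

lemma poly_Rats_if_infinitely_often:
  fixes p :: "real poly"
  assumes "infinite {t::int. poly p (of_int t) \<in> \<rat>}"
  shows "poly p (of_int s) \<in> \<rat>"
  using assms
proof (induction "degree p" arbitrary: p s rule: less_induct)
  case less
  obtain t0 where t0: "poly p (of_int t0) \<in> \<rat>"
    using less.prems not_finite_existsD by auto
  define c where "c = poly p (of_int t0)"
  show ?case
  proof (cases "degree p = 0")
    case True
    then obtain a where "p = [:a:]" by (metis degree_0_id)
    with t0 show ?thesis by simp
  next
    case False
    have "poly (p - [:c:]) (of_int t0) = 0" by (simp add: c_def)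
    then obtain q where q: "p - [:c:] = [:- of_int t0, 1:] * q"
      using poly_eq_0_iff_dvd by (metis dvdE)
    have pq: "poly p x = c + (x - of_int t0) * poly q x" for x
      using arg_cong[OF q, of "\<lambda>r. poly r x"] by (simp add: algebra_simps)
    have "q \<noteq> 0"
    proof
      assume "q = 0"
      then have "p = [:c:]" using q by simp
      with False show False by simp
    qed
    then have "degree (p - [:c:]) = Suc (degree q)"
      unfolding q by (subst degree_mult_eq) auto
    moreover have "degree (p - [:c:]) \<le> degree p"
      by (rule degree_diff_le) auto
    ultimately have deg: "degree q < degree p" by simp
    have "{t::int. poly p (of_int t) \<in> \<rat>} - {t0} \<subseteq> {t. poly q (of_int t) \<in> \<rat>}"
    proof
      fix t assume t: "t \<in> {t::int. poly p (of_int t) \<in> \<rat>} - {t0}"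
      then have "poly q (of_int t) = (poly p (of_int t) - c) / (of_int (t - t0))"
        by (simp add: pq)
      also have "\<dots> \<in> \<rat>" using t t0 by (simp add: c_def)
      finally show "t \<in> {t. poly q (of_int t) \<in> \<rat>}" by simp
    qed
    moreover have "infinite ({t::int. poly p (of_int t) \<in> \<rat>} - {t0})"
      using less.prems by simp
    ultimately have "infinite {t::int. poly q (of_int t) \<in> \<rat>}"
      using finite_subset by blast
    then have "poly q (of_int s) \<in> \<rat>" using less.hyps deg by blast
    then show ?thesis using t0 by (simp add: pq c_def[symmetric])
  qed
qed

text \<open>Join a point \<open>x\<close> that works for \<open>K\<close> to a point
  \<open>y\<close> that works for \<open>k0\<close>. Along the path every \<open>f k\<close> is a
  polynomial that is irrational at 0 or at 1, so only finitely many parameters are bad for some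
  \<open>k\<close>, and some integer avoids them all.\<close>

lemma common_irrational_value:
  fixes f :: "'k \<Rightarrow> 'x \<Rightarrow> real" and path :: "'x \<Rightarrow> 'x \<Rightarrow> int \<Rightarrow> 'x"
  assumes "finite K"
    and "\<And>k x y. \<exists>p. \<forall>t. f k (path x y t) = poly p (of_int t)"
    and ends: "\<And>x y. path x y 0 = x" "\<And>x y. path x y 1 = y"
    and "\<And>k. k \<in> K \<Longrightarrow> \<exists>x. f k x \<notin> \<rat>"
  shows "\<exists>x. \<forall>k\<in>K. f k x \<notin> \<rat>"
  using assms(1,5)
proof (induction K rule: finite_induct)
  case (insert k0 K)
  obtain x where x: "\<forall>k\<in>K. f k x \<notin> \<rat>" using insert by auto
  obtain y where y: "f k0 y \<notin> \<rat>" using insert by auto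
  have fin: "finite {t. f k (path x y t) \<in> \<rat>}" if "k \<in> insert k0 K" for k
  proof -
    obtain p where p: "\<And>t. f k (path x y t) = poly p (of_int t)" using assms(2) by blast
    have "\<exists>s. poly p (of_int s) \<notin> \<rat>"
    proof (cases "k = k0")
      case True
      with y p[of 1] show ?thesis by (intro exI[of _ 1]) (simp add: ends)
    next
      case False
      with x that p[of 0] show ?thesis by (intro exI[of _ 0]) (auto simp: ends)
    qed
    then show ?thesis unfolding p using poly_Rats_if_infinitely_often by blast
  qed
  have "finite (\<Union>k\<in>insert k0 K. {t. f k (path x y t) \<in> \<rat>})"
    using fin insert.hyps by blast
  then obtain t where "t \<notin> (\<Union>k\<in>insert k0 K. {t. f k (path x y t) \<in> \<rat>})"
    using ex_new_if_finite[OF infinite_UNIV_int] by blast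
  then show ?case by (intro exI[of _ "path x y t"]) auto
qed simp

section \<open>Bilinear forms on pairs of orthogonal integer vectors\<close>

definition pairing :: "('d::finite \<Rightarrow> 'd \<Rightarrow> real) \<Rightarrow> ('d \<Rightarrow> int) \<Rightarrow> ('d \<Rightarrow> int) \<Rightarrow> real" where
  "pairing \<theta> v w = (\<Sum>p\<in>UNIV. \<Sum>q\<in>UNIV. \<theta> p q * of_int (v p) * of_int (w q))"

text \<open>This is \<open>(a^T - a) v\<close>, a skew-symmetric matrix applied to \<open>v\<close>,
  hence automatically orthogonal to \<open>v\<close>. Orthogonality is not preserved along lines of
  pairs \<open>(v, w)\<close>, whereas the parameters \<open>(v, a)\<close> are
  unconstrained.\<close>

definition skew_image :: "('d::finite \<Rightarrow> 'd \<Rightarrow> int) \<Rightarrow> ('d \<Rightarrow> int) \<Rightarrow> 'd \<Rightarrow> int" where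
  "skew_image a v s = (\<Sum>i\<in>UNIV. (a i s - a s i) * v i)"

lemma skew_image_orthogonal: "(\<Sum>s\<in>UNIV. v s * skew_image a v s) = 0"
proof -
  have "(\<Sum>s\<in>UNIV. v s * skew_image a v s)
      = (\<Sum>s\<in>UNIV. \<Sum>i\<in>UNIV. a i s * v i * v s) - (\<Sum>s\<in>UNIV. \<Sum>i\<in>UNIV. a s i * v i * v s)"
    by (simp add: skew_image_def sum_distrib_left sum_subtractf[symmetric] algebra_simps)
  also have "(\<Sum>s\<in>UNIV. \<Sum>i\<in>UNIV. a i s * v i * v s) = (\<Sum>i\<in>UNIV. \<Sum>s\<in>UNIV. a i s * v i * v s)"
    by (rule sum.swap)
  finally show ?thesis by (simp add: mult_ac)
qed

lemma skew_image_unit: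
  assumes "p \<noteq> q"
  shows "skew_image (\<lambda>i j. of_bool (i = p \<and> j = q)) (\<lambda>i. of_bool (i = p)) = (\<lambda>i. of_bool (i = q))"
proof
  fix s
  have "(of_bool (i = p \<and> s = q) - of_bool (s = p \<and> i = q)) * of_bool (i = p)
      = (if i = p then of_bool (s = q) else (0::int))" for i
    using assms by auto
  then show "skew_image (\<lambda>i j. of_bool (i = p \<and> j = q)) (\<lambda>i. of_bool (i = p)) s = of_bool (s = q)"
    by (simp add: skew_image_def)
qed

text \<open>Produces the rank-one matrix \<open>(e_p + e_q) (e_p - e_q)^T\<close>, whose diagonal
  part is the difference of two diagonal matrix units.\<close>

lemma skew_image_unit_sum:
  assumes "p \<noteq> q"
  shows "skew_image (\<lambda>i j. - of_bool (i = p \<and> j = q)) (\<lambda>i. of_bool (i = p) + of_bool (i = q))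
    = (\<lambda>i. of_bool (i = p) - of_bool (i = q))"
proof
  fix s
  show "skew_image (\<lambda>i j. - of_bool (i = p \<and> j = q)) (\<lambda>i. of_bool (i = p) + of_bool (i = q)) s
    = of_bool (s = p) - of_bool (s = q)"
    using assms
    by (simp add: skew_image_def algebra_simps sum.distrib sum_subtractf sum_negf of_bool_conj
        sum_of_bool_mult_eq sum_mult_of_bool_eq)
qed

lemma pairing_unit: "pairing \<theta> (\<lambda>i. of_bool (i = p)) (\<lambda>i. of_bool (i = q)) = \<theta> p q"
  by (simp add: pairing_def sum_mult_of_bool_eq if_distrib[of "\<lambda>A. sum _ ({q} \<inter> A)"] cong: if_cong)

lemma pairing_add_left: "pairing \<theta> (\<lambda>i. u i + v i) w = pairing \<theta> u w + pairing \<theta> v w"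
  by (simp add: pairing_def algebra_simps sum.distrib)

lemma pairing_diff_right: "pairing \<theta> v (\<lambda>i. u i - w i) = pairing \<theta> v u - pairing \<theta> v w"
  by (simp add: pairing_def algebra_simps sum_subtractf)

text \<open>The hypothesis says that \<open>\<theta>\<close> is not rational modulo scalar matrices.
  An irrational off-diagonal entry is picked out by two unit vectors; if all of these are rational,
  the vectors \<open>e_p + e_q\<close> and \<open>e_p - e_q\<close> give an irrational diagonal
  difference up to a rational error.\<close>

lemma ex_irrational_pairing:
  fixes \<theta> :: "'d::finite \<Rightarrow> 'd \<Rightarrow> real"
  assumes "\<exists>p q. p \<noteq> q \<and> (\<theta> p q \<notin> \<rat> \<or> \<theta> p p - \<theta> q q \<notin> \<rat>)"
  shows "\<exists>v a. pairing \<theta> v (skew_image a v) \<notin> \<rat>"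
proof (cases "\<exists>p q. p \<noteq> q \<and> \<theta> p q \<notin> \<rat>")
  case True
  then obtain p q where pq: "p \<noteq> q" "\<theta> p q \<notin> \<rat>" by blast
  with pq(2) show ?thesis
    by (intro exI[of _ "\<lambda>i. of_bool (i = p)"] exI[of _ "\<lambda>i j. of_bool (i = p \<and> j = q)"])
      (simp only: skew_image_unit[OF pq(1)] pairing_unit not_False_eq_True)
next
  case False
  then obtain p q where pq: "p \<noteq> q" "\<theta> p p - \<theta> q q \<notin> \<rat>" using assms by blast
  have rat: "\<theta> p q - \<theta> q p \<in> \<rat>" using False pq(1) by (metis Rats_diff)
  have "pairing \<theta> (\<lambda>i. of_bool (i = p) + of_bool (i = q)) (\<lambda>i. of_bool (i = p) - of_bool (i = q))
      = (\<theta> p p - \<theta> q q) - (\<theta> p q - \<theta> q p)"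
    unfolding pairing_add_left pairing_diff_right pairing_unit by simp
  moreover have "(\<theta> p p - \<theta> q q) - (\<theta> p q - \<theta> q p) \<notin> \<rat>"
  proof
    assume "(\<theta> p p - \<theta> q q) - (\<theta> p q - \<theta> q p) \<in> \<rat>"
    from Rats_add[OF this rat] pq(2) show False by simp
  qed
  ultimately show ?thesis
    by (intro exI[of _ "\<lambda>i. of_bool (i = p) + of_bool (i = q)"]
        exI[of _ "\<lambda>i j. - of_bool (i = p \<and> j = q)"])
      (simp only: skew_image_unit_sum[OF pq(1)] not_False_eq_True)
qed

text \<open>In the free parameters \<open>(v, a)\<close> the pairing is a cubic polynomial along
  every line, so the path argument finds one orthogonal pair serving all of
  \<open>K\<close>.\<close>

lemma common_irrational_pairing:
  fixes K :: "('d::finite \<Rightarrow> 'd \<Rightarrow> real) set"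
  assumes "finite K"
    and "\<And>\<theta>. \<theta> \<in> K \<Longrightarrow> \<exists>p q. p \<noteq> q \<and> (\<theta> p q \<notin> \<rat> \<or> \<theta> p p - \<theta> q q \<notin> \<rat>)"
  shows "\<exists>v w. (\<Sum>i\<in>UNIV. v i * w i) = 0 \<and> (\<forall>\<theta>\<in>K. pairing \<theta> v w \<notin> \<rat>)"
proof -
  define f :: "('d \<Rightarrow> 'd \<Rightarrow> real) \<Rightarrow> ('d \<Rightarrow> int) \<times> ('d \<Rightarrow> 'd \<Rightarrow> int) \<Rightarrow> real"
    where "f = (\<lambda>\<theta> (v, a). pairing \<theta> v (skew_image a v))"
  define path :: "('d \<Rightarrow> int) \<times> ('d \<Rightarrow> 'd \<Rightarrow> int) \<Rightarrow> ('d \<Rightarrow> int) \<times> ('d \<Rightarrow> 'd \<Rightarrow> int) \<Rightarrow> int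
      \<Rightarrow> ('d \<Rightarrow> int) \<times> ('d \<Rightarrow> 'd \<Rightarrow> int)"
    \<comment> \<open>Lines in the parameter space; \<open>t\<close> runs over all integers, not
      only between the endpoints 0 and 1.\<close>
    where "path = (\<lambda>(v, a) (v', a') t. (\<lambda>i. v i + t * (v' i - v i), \<lambda>i j. a i j + t * (a' i j - a i j)))"
  have "\<exists>x. \<forall>\<theta>\<in>K. f \<theta> x \<notin> \<rat>"
  proof (rule common_irrational_value[OF assms(1)])
    fix \<theta> :: "'d \<Rightarrow> 'd \<Rightarrow> real" and x y :: "('d \<Rightarrow> int) \<times> ('d \<Rightarrow> 'd \<Rightarrow> int)"
    obtain v a where x: "x = (v, a)" by (cases x)
    obtain v' a' where y: "y = (v', a')" by (cases y)
    define V where "V = (\<lambda>i. [:real_of_int (v i), of_int (v' i - v i):])"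
    define A where "A = (\<lambda>i j. [:real_of_int (a i j), of_int (a' i j - a i j):])"
    have V: "poly (V i) t = v i + t * (v' i - v i)" for i t
      by (simp add: V_def)
    have A: "poly (A i j) t = a i j + t * (a' i j - a i j)" for i j t
      by (simp add: A_def)
    let ?p = "\<Sum>p\<in>UNIV. \<Sum>q\<in>UNIV. smult (\<theta> p q) (V p * (\<Sum>i\<in>UNIV. (A i q - A q i) * V i))"
    have "f \<theta> (path x y t) = poly ?p (of_int t)" for t
      by (simp add: f_def path_def x y pairing_def skew_image_def poly_sum V A mult.assoc)
    then show "\<exists>p. \<forall>t. f \<theta> (path x y t) = poly p (of_int t)" by blast
  next
    show "\<exists>x. f \<theta> x \<notin> \<rat>" if "\<theta> \<in> K" for \<theta>
      using ex_irrational_pairing[OF assms(2)[OF that]] by (auto simp: f_def)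
  qed (auto simp: path_def split: prod.splits)
  then obtain v a where "\<forall>\<theta>\<in>K. pairing \<theta> v (skew_image a v) \<notin> \<rat>"
    by (auto simp: f_def)
  then show ?thesis using skew_image_orthogonal by blast
qed

section \<open>Quadratic Weyl sums\<close>

definition avg :: "(nat \<Rightarrow> complex) \<Rightarrow> nat \<Rightarrow> complex" where
  "avg u T = (\<Sum>t<T. u t) / of_nat T"

lemma avg_sum: "avg (\<lambda>t. \<Sum>i\<in>I. f i t) T = (\<Sum>i\<in>I. avg (f i) T)"
  unfolding avg_def by (subst sum.swap) (simp add: sum_divide_distrib)

lemma avg_cmult: "avg (\<lambda>t. c * f t) T = c * avg f T"
  by (simp add: avg_def sum_distrib_left)

lemma norm_avg_le:
  assumes "\<And>t. norm (u t) \<le> c"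
  shows "norm (avg u T) \<le> c"
proof (cases "T = 0")
  case True
  have "0 \<le> c" using assms[of 0] norm_ge_zero order_trans by blast
  with True show ?thesis by (simp add: avg_def)
next
  case False
  have "norm (\<Sum>t<T. u t) \<le> of_nat (card {..<T}) * c"
    by (rule sum_norm_bound) (use assms in auto)
  with False show ?thesis by (simp add: avg_def norm_divide field_simps)
qed

text \<open>Cauchy-Schwarz against the constant 1. Writing the right side as an average of
  \<open>u t * cnj (u t)\<close> lets it be expanded bilinearly later.\<close>

lemma norm_avg_power2_le: "(norm (avg u T))\<^sup>2 \<le> Re (avg (\<lambda>t. u t * cnj (u t)) T)"
proof (cases "T = 0")
  case False
  have "(norm (\<Sum>t<T. u t))\<^sup>2 \<le> (\<Sum>t<T. 1 * norm (u t))\<^sup>2"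
    by (intro power_mono) (simp_all add: norm_sum)
  also have "\<dots> \<le> (\<Sum>t<T. 1\<^sup>2) * (\<Sum>t<T. (norm (u t))\<^sup>2)"
    by (rule Cauchy_Schwarz_ineq_sum)
  finally have "(norm (\<Sum>t<T. u t))\<^sup>2 \<le> T * (\<Sum>t<T. (norm (u t))\<^sup>2)" by simp
  then have "(norm (avg u T))\<^sup>2 \<le> (\<Sum>t<T. (norm (u t))\<^sup>2) / T"
    using False by (simp add: avg_def norm_divide field_simps power2_eq_square)
  also have "\<dots> = Re (avg (\<lambda>t. u t * cnj (u t)) T)"
    by (simp add: avg_def Re_divide_of_nat complex_norm_square[symmetric] del: of_real_power)
  finally show ?thesis .
qed (simp add: avg_def)

text \<open>A shift by \<open>h\<close> changes only \<open>h\<close> terms at each end of the sum,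
  an error of at most \<open>2 * h\<close> before division by \<open>T\<close>.\<close>

lemma avg_shift_tendsto:
  assumes "\<And>t. norm (u t) = 1"
  shows "(\<lambda>T. avg (\<lambda>t. u (t + h)) T - avg u T) \<longlonglongrightarrow> 0"
proof (rule Lim_null_comparison)
  have "norm (avg (\<lambda>t. u (t + h)) T - avg u T) \<le> 2 * real h / real T" for T
  proof -
    have "(\<Sum>t<m + n. u t) = (\<Sum>t<m. u t) + (\<Sum>t<n. u (t + m))" for m n
      by (induction n) (auto simp: add_ac)
    from this[of T h] this[of h T]
    have "(\<Sum>t<T. u (t + h)) + (\<Sum>t<h. u t) = (\<Sum>t<T. u t) + (\<Sum>t<h. u (t + T))"
      by (simp add: add_ac)
    then have "(\<Sum>t<T. u (t + h)) - (\<Sum>t<T. u t) = (\<Sum>t<h. u (t + T)) - (\<Sum>t<h. u t)"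
      by (simp add: algebra_simps)
    moreover have "norm (\<Sum>t<h. u (t + T)) \<le> h" "norm (\<Sum>t<h. u t) \<le> h"
      using sum_norm_bound[of "{..<h}" "\<lambda>t. u (t + T)" 1] sum_norm_bound[of "{..<h}" u 1] assms
      by simp_all
    ultimately have "norm ((\<Sum>t<T. u (t + h)) - (\<Sum>t<T. u t)) \<le> 2 * h"
      using norm_triangle_ineq4[of "\<Sum>t<h. u (t + T)" "\<Sum>t<h. u t"] by simp
    then show ?thesis
      by (simp add: avg_def norm_divide divide_right_mono flip: diff_divide_distrib)
  qed
  then show "\<forall>\<^sub>F T in sequentially. norm (avg (\<lambda>t. u (t + h)) T - avg u T) \<le> 2 * real h / real T" by simp
  show "(\<lambda>T. 2 * real h / real T) \<longlonglongrightarrow> 0" by (rule lim_const_over_n)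
qed

text \<open>Up to a vanishing error \<open>u\<close> may be replaced by its moving average
  \<open>w\<close> over \<open>H\<close> shifts. By Cauchy-Schwarz the squared average of
  \<open>w\<close> is at most the average of its squared modulus, which expands into correlations of
  shifts; in the limit only the diagonal survives and contributes \<open>1 / H\<close>.\<close>

lemma van_der_Corput:
  assumes norm: "\<And>t. norm (u t) = 1"
    and corr: "\<And>h k. h \<noteq> k \<Longrightarrow> avg (\<lambda>t. u (t + h) * cnj (u (t + k))) \<longlonglongrightarrow> 0"
  shows "avg u \<longlonglongrightarrow> 0"
proof (rule LIMSEQ_I)
  fix e :: real assume "0 < e"
  \<comment> \<open>\<open>H\<close> makes the diagonal contribution less than
    \<open>(e / 2)^2\<close>; the other \<open>e / 2\<close> is reserved for replacing
    \<open>u\<close> by \<open>w\<close>.\<close>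
  obtain H :: nat where "0 < H" and H: "1 / H < (e / 2)\<^sup>2"
    using ex_inverse_of_nat_less[of "(e / 2)\<^sup>2"] \<open>0 < e\<close> by (auto simp: inverse_eq_divide)
  define w where "w = (\<lambda>t. \<Sum>h<H. (1 / of_nat H) * u (t + h))"
  have "(\<lambda>T. \<Sum>h<H. (1 / of_nat H) * (avg (\<lambda>t. u (t + h)) T - avg u T))
      \<longlonglongrightarrow> (\<Sum>h<H. (1 / of_nat H) * 0)"
    by (intro tendsto_intros avg_shift_tendsto norm)
  then have lim1: "(\<lambda>T. avg w T - avg u T) \<longlonglongrightarrow> 0"
    unfolding w_def avg_sum avg_cmult
    by (simp add: right_diff_distrib sum_subtractf \<open>0 < H\<close> flip: sum_distrib_left)
  have self: "avg (\<lambda>t. u (t + h) * cnj (u (t + h))) \<longlonglongrightarrow> 1" for h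
  proof (rule tendsto_eventually)
    have "u t * cnj (u t) = 1" for t
      using norm[of t] by (simp flip: complex_norm_square)
    then show "\<forall>\<^sub>F T in sequentially. avg (\<lambda>t. u (t + h) * cnj (u (t + h))) T = 1"
      by (auto simp: avg_def eventually_sequentially intro!: exI[of _ 1])
  qed
  have "w t * cnj (w t)
      = (\<Sum>h<H. \<Sum>k<H. (1 / of_nat H)\<^sup>2 * (u (t + h) * cnj (u (t + k))))" for t
    by (simp add: w_def sum_product power2_eq_square mult_ac)
  then have "avg (\<lambda>t. w t * cnj (w t))
      = (\<lambda>T. \<Sum>h<H. \<Sum>k<H. (1 / of_nat H)\<^sup>2 * avg (\<lambda>t. u (t + h) * cnj (u (t + k))) T)"
    by (simp add: avg_sum avg_cmult fun_eq_iff)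
  moreover have "\<dots> \<longlonglongrightarrow> (\<Sum>h<H. \<Sum>k<H. (1 / of_nat H)\<^sup>2 * (if h = k then 1 else 0))"
    by (intro tendsto_intros) (use corr self in auto)
  ultimately have "avg (\<lambda>t. w t * cnj (w t)) \<longlonglongrightarrow> 1 / of_nat H"
    using \<open>0 < H\<close> by (simp add: power2_eq_square flip: sum_divide_distrib)
  then have "(\<lambda>T. Re (avg (\<lambda>t. w t * cnj (w t)) T)) \<longlonglongrightarrow> Re (1 / of_nat H)"
    by (rule tendsto_Re)
  then have "\<forall>\<^sub>F T in sequentially. Re (avg (\<lambda>t. w t * cnj (w t)) T) < (e / 2)\<^sup>2"
    using H by (intro order_tendstoD(2)) (auto simp: Re_divide_of_nat)
  moreover have "\<forall>\<^sub>F T in sequentially. norm (avg w T - avg u T) < e / 2"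
    using lim1 \<open>0 < e\<close> tendstoD[OF lim1, of "e / 2"] by simp
  ultimately have "\<forall>\<^sub>F T in sequentially. norm (avg u T) < e"
  proof eventually_elim
    case (elim T)
    have "(norm (avg w T))\<^sup>2 < (e / 2)\<^sup>2"
      using norm_avg_power2_le[of w T] elim(1) by linarith
    then have "norm (avg w T) < e / 2"
      by (rule power2_less_imp_less) (use \<open>0 < e\<close> in simp)
    then show ?case
      using elim(2) norm_triangle_ineq4[of "avg w T" "avg w T - avg u T"] by simp
  qed
  then show "\<exists>T0. \<forall>T\<ge>T0. norm (avg u T - 0) < e" by (simp add: eventually_sequentially)
qed

section \<open>Linear and quadratic phases\<close>

lemma cis_2pi_eq_1_iff: "cis (2 * pi * x) = 1 \<longleftrightarrow> x \<in> \<int>"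
proof
  assume "cis (2 * pi * x) = 1"
  then have "cos (2 * pi * x) = 1" by (simp add: complex_eq_iff)
  then obtain n :: int where "2 * pi * x = of_int n * (2 * pi)" using cos_one_2pi_int
    by (auto simp: mult_ac)
  then have "x = of_int n" by simp
  then show "x \<in> \<int>" by simp
qed (rule cis_multiple_2pi)

lemma avg_geometric_tendsto_0:
  assumes "norm z = 1" "z \<noteq> 1"
  shows "avg (\<lambda>t. z ^ t) \<longlonglongrightarrow> 0"
proof (rule Lim_null_comparison)
  have "norm (avg (\<lambda>t. z ^ t) T) \<le> 2 / norm (z - 1) / real T" for T
  proof -
    have "norm (z ^ T - 1) \<le> 2"
      using norm_triangle_ineq4[of "z ^ T" 1] assms(1) by (simp add: norm_power)
    then show ?thesis using assms(2)
      by (simp add: avg_def geometric_sum norm_divide norm_mult divide_right_mono flip: divide_divide_eq_left)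
  qed
  then show "\<forall>\<^sub>F T in sequentially. norm (avg (\<lambda>t. z ^ t) T) \<le> 2 / norm (z - 1) / real T" by simp
  show "(\<lambda>T. 2 / norm (z - 1) / real T) \<longlonglongrightarrow> 0" by (rule lim_const_over_n)
qed

text \<open>Correlating two distinct shifts cancels the quadratic term and leaves a geometric
  sequence of ratio \<open>cis (2 * pi * (\<gamma> * d))\<close>, which is not 1 because
  \<open>\<gamma>\<close> is irrational.\<close>

lemma Weyl_quadratic:
  fixes \<alpha> \<beta> \<gamma> :: real
  assumes "\<gamma> \<notin> \<rat>"
  shows "avg (\<lambda>t. cis (2 * pi * (\<alpha> + \<beta> * t + \<gamma> * (real t)\<^sup>2))) \<longlonglongrightarrow> 0"
proof (rule van_der_Corput)
  fix h k :: nat assume "h \<noteq> k"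
  define d where "d = 2 * (real h - real k)"
  have "\<gamma> * d \<notin> \<int>"
  proof
    assume "\<gamma> * d \<in> \<int>"
    then have "\<gamma> * d / d \<in> \<rat>"
      by (intro Rats_divide) (auto simp: d_def Ints_subset_Rats[THEN subsetD])
    with assms \<open>h \<noteq> k\<close> show False by (simp add: d_def)
  qed
  then have ne: "cis (2 * pi * (\<gamma> * d)) \<noteq> 1" by (simp only: cis_2pi_eq_1_iff not_False_eq_True)
  define c where "c = cis (2 * pi * (\<beta> * (real h - real k) + \<gamma> * ((real h)\<^sup>2 - (real k)\<^sup>2)))"
  have "cis (2 * pi * (\<alpha> + \<beta> * real (t + h) + \<gamma> * (real (t + h))\<^sup>2))
        * cnj (cis (2 * pi * (\<alpha> + \<beta> * real (t + k) + \<gamma> * (real (t + k))\<^sup>2)))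
      = c * cis (2 * pi * (\<gamma> * d)) ^ t" for t
    unfolding c_def cis_cnj Complex.DeMoivre cis_mult
    by (rule arg_cong[where f = cis]) (simp add: d_def algebra_simps power2_eq_square)
  then show "avg (\<lambda>t. cis (2 * pi * (\<alpha> + \<beta> * real (t + h) + \<gamma> * (real (t + h))\<^sup>2))
        * cnj (cis (2 * pi * (\<alpha> + \<beta> * real (t + k) + \<gamma> * (real (t + k))\<^sup>2)))) \<longlonglongrightarrow> 0"
    using tendsto_mult_right_zero[OF avg_geometric_tendsto_0[OF norm_cis ne], of c]
    by (simp add: avg_cmult[abs_def])
qed simp

text \<open>With \<open>k = CARD('n)\<close> this will make the kernel bound \<open>q ^ N\<close>
  off the neighbourhood smaller than a lower bound for the constant Fourier coefficient.\<close>

lemma poly_times_geometric_tendsto_0: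
  fixes q :: real
  assumes "0 \<le> q" "q < 1"
  shows "(\<lambda>N. (2 * real N) ^ k * q ^ N) \<longlonglongrightarrow> 0"
proof (cases "q = 0")
  case True
  \<comment> \<open>Since \<open>0 ^ 0 = 1\<close>, vanishing is claimed only from
    \<open>N = 1\<close> on.\<close>
  have "\<forall>\<^sub>F N in sequentially. (2 * real N) ^ k * q ^ N = 0"
    using eventually_gt_at_top[of 0] by eventually_elim (simp add: True)
  then show ?thesis by (rule tendsto_eventually)
next
  case False
  define b where "b = - ln q"
  have "0 < b" and q: "q = exp (- b)" using assms False by (auto simp: b_def)
  have "(\<lambda>N. (2 * real N) powr real k * exp (- b * real N)) \<longlonglongrightarrow> 0"
    using \<open>0 < b\<close> by real_asymp
  moreover have "\<forall>\<^sub>F N in sequentially.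
      (2 * real N) powr real k * exp (- b * real N) = (2 * real N) ^ k * q ^ N"
    using eventually_gt_at_top[of 0]
    by eventually_elim (simp add: powr_realpow q mult.commute flip: exp_of_nat_mult)
  ultimately show ?thesis by (rule Lim_transform_eventually)
qed

section \<open>Detecting a neighbourhood of the unit in the torus\<close>

text \<open>On the unit circle each factor equals \<open>1 - |z_i - 1|^2 / 4\<close>, so it is at
  most 1. Outside \<open>U\<close> some coordinate stays a fixed distance \<open>d\<close> away from
  1, and that single factor bounds the product.\<close>

lemma torus_nbhd_kernel_bound:
  fixes U :: "(complex^'n) set"
  assumes "openin (top_of_set torus) U" "torus_unit \<in> U"
  shows "\<exists>q. 0 \<le> q \<and> q < 1 \<and>
    (\<forall>z\<in>torus - U. (\<Prod>i\<in>UNIV. (norm (1 + z $ i))\<^sup>2 / 4) \<le> q)"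
proof -
  obtain e where e: "0 < e" "\<And>z. z \<in> torus \<Longrightarrow> dist z torus_unit < e \<Longrightarrow> z \<in> U"
    using assms unfolding openin_euclidean_subtopology_iff by blast
  \<comment> \<open>If every coordinate were within \<open>d\<close> of 1, the point would be within
    \<open>e\<close> of the unit. The cap at 1 keeps \<open>1 - d\<^sup>2 / 4\<close>
    nonnegative.\<close>
  define d where "d = min 1 (e / CARD('n))"
  have d: "0 < d" "d \<le> 1" using e by (auto simp: d_def)
  then have "d\<^sup>2 \<le> 1" by (simp add: power_le_one)
  have "(\<Prod>i\<in>UNIV. (norm (1 + z $ i))\<^sup>2 / 4) \<le> 1 - d\<^sup>2 / 4" if z: "z \<in> torus - U" for z
  proof -
    have norm1: "norm (z $ i) = 1" for i using z by (simp add: torus_def)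
    have par: "(norm (1 + z $ i))\<^sup>2 / 4 = 1 - (norm (z $ i - 1))\<^sup>2 / 4" for i
    proof -
      have "(Re (z $ i))\<^sup>2 + (Im (z $ i))\<^sup>2 = 1"
        using norm1[of i] by (metis cmod_power2 one_power2)
      then show ?thesis unfolding cmod_power2 by (simp add: power2_eq_square algebra_simps) argo
    qed
    have le1: "(norm (1 + z $ i))\<^sup>2 / 4 \<le> 1" for i by (subst par) simp
    have "e \<le> norm (z - torus_unit)" using e(2)[of z] z by (fastforce simp: dist_norm)
    also have "\<dots> \<le> (\<Sum>i\<in>UNIV. norm (z $ i - 1))"
      unfolding norm_vec_def torus_unit_def
      by (rule order_trans[OF L2_set_le_sum]) auto
    finally have sum_ge: "e \<le> (\<Sum>i\<in>UNIV. norm (z $ i - 1))" .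
    have "\<exists>i. d \<le> norm (z $ i - 1)"
    proof (rule ccontr)
      assume "\<not> ?thesis"
      then have "(\<Sum>i\<in>UNIV. norm (z $ i - 1)) < (\<Sum>i\<in>(UNIV :: 'n set). d)"
        by (intro sum_strict_mono) (auto simp: not_le)
      also have "\<dots> \<le> e" by (simp add: d_def min_def field_simps)
      finally show False using sum_ge by simp
    qed
    then obtain i where i: "d \<le> norm (z $ i - 1)" by blast
    have "(\<Prod>i\<in>UNIV. (norm (1 + z $ i))\<^sup>2 / 4)
        = (norm (1 + z $ i))\<^sup>2 / 4 * (\<Prod>i\<in>UNIV - {i}. (norm (1 + z $ i))\<^sup>2 / 4)"
      by (rule prod.remove) auto
    also have "\<dots> \<le> (norm (1 + z $ i))\<^sup>2 / 4 * 1"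
      by (intro mult_left_mono prod_le_1 conjI le1) auto
    also have "\<dots> \<le> 1 - d\<^sup>2 / 4"
      using power_mono[OF i, of 2] d by (simp add: par)
    finally show ?thesis .
  qed
  then show ?thesis using d \<open>d\<^sup>2 \<le> 1\<close> by (intro exI[of _ "1 - d\<^sup>2 / 4"]) auto
qed

text \<open>For \<open>z = cis x\<close> one has \<open>(1 + z)^2 / (4 z) = cos(x/2)^2\<close>, so
  the left side is a product of powers of cosines (up to normalisation a de la Vallee Poussin
  kernel). The binomial theorem gives its Fourier expansion, with frequencies between
  \<open>-N\<close> and \<open>N\<close>.\<close>

lemma Fejer_kernel_expansion:
  fixes z :: "complex^'n"
  assumes "z \<in> torus"
  shows "(\<Prod>i\<in>UNIV. (1 + z $ i) ^ (2 * N) * z $ i powi (- int N) / 4 ^ N)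
    = (\<Sum>j\<in>UNIV \<rightarrow> {..2 * N}. (\<Prod>i\<in>UNIV. of_nat (2 * N choose j i) / 4 ^ N)
        * (\<Prod>i\<in>UNIV. z $ i powi (int (j i) - int N)))"
proof -
  have "(1 + z $ i) ^ (2 * N) * z $ i powi (- int N) / 4 ^ N
    = (\<Sum>j\<le>2 * N. of_nat (2 * N choose j) / 4 ^ N * z $ i powi (int j - int N))" for i
  proof -
    have "z $ i \<noteq> 0" using assms by (auto simp: torus_def dest: spec[of _ i])
    then have "z $ i ^ j * z $ i powi (- int N) = z $ i powi (int j - int N)" for j
      by (simp add: power_int_diff power_int_minus field_simps)
    then show ?thesis
      by (subst add.commute, subst binomial_ring)
        (simp add: sum_distrib_right sum_divide_distrib mult.assoc)
  qed
  then have "(\<Prod>i\<in>UNIV. (1 + z $ i) ^ (2 * N) * z $ i powi (- int N) / 4 ^ N)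
    = (\<Prod>i\<in>UNIV. \<Sum>j\<le>2 * N. of_nat (2 * N choose j) / 4 ^ N * z $ i powi (int j - int N))"
    by simp
  also have "\<dots> = (\<Sum>j\<in>PiE UNIV (\<lambda>_. {..2 * N}).
      \<Prod>i\<in>UNIV. of_nat (2 * N choose j i) / 4 ^ N * z $ i powi (int (j i) - int N))"
    by (rule prod_sum_PiE) auto
  finally show ?thesis by (simp only: prod.distrib PiE_UNIV_domain)
qed

text \<open>If the sequence avoided \<open>U\<close>, the averages of the kernel would stay below
  \<open>q ^ N\<close>. But they tend to the constant coefficient, as all other characters average
  to 0, and that coefficient is larger for suitable \<open>N\<close>. Since \<open>N\<close> depends
  only on \<open>U\<close>, finitely many characters suffice.\<close>

lemma Bohr_recurrence:
  fixes U :: "(complex^'n) set"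
  assumes U: "openin (top_of_set torus) U" "torus_unit \<in> U"
  shows "\<exists>N::nat. \<forall>z :: nat \<Rightarrow> complex^'n. (\<forall>t. z t \<in> torus) \<longrightarrow>
    (\<forall>k. (\<exists>i. k i \<noteq> 0) \<and> (\<forall>i. \<bar>k i\<bar> \<le> int N) \<longrightarrow>
      avg (\<lambda>t. \<Prod>i\<in>UNIV. z t $ i powi k i) \<longlonglongrightarrow> 0) \<longrightarrow> (\<exists>t. z t \<in> U)"
proof -
  obtain q where q: "0 \<le> q" "q < 1"
    and bound: "\<And>z. z \<in> torus - U \<Longrightarrow> (\<Prod>i\<in>UNIV. (norm (1 + z $ i))\<^sup>2 / 4) \<le> q"
    using torus_nbhd_kernel_bound[OF U] by blast
  have "\<forall>\<^sub>F N in sequentially. (2 * real N) ^ CARD('n) * q ^ N < 1 \<and> 0 < N"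
    using order_tendstoD(2)[OF poly_times_geometric_tendsto_0[OF q], of 1 "CARD('n)"]
      eventually_gt_at_top[of 0] by (simp add: eventually_conj_iff)
  then obtain N where N: "(2 * real N) ^ CARD('n) * q ^ N < 1" "0 < N"
    by (auto simp: eventually_sequentially)
  define c :: real where "c = real (2 * N choose N) / 4 ^ N"
  have "q ^ N < c ^ CARD('n)"
  proof -
    have "q ^ N < (1 / (2 * real N)) ^ CARD('n)"
      using N by (simp add: field_simps)
    \<comment> \<open>The central binomial coefficient is at least \<open>4 ^ N / (2 * N)\<close>,
      so the constant coefficient decays only polynomially in \<open>N\<close>.\<close>
    also have "1 / (2 * real N) \<le> c"
      using central_binomial_lower_bound[OF N(2)] by (simp add: c_def field_simps)
    then have "(1 / (2 * real N)) ^ CARD('n) \<le> c ^ CARD('n)"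
      by (intro power_mono) auto
    finally show ?thesis .
  qed
  have "\<exists>t. z t \<in> U"
    if torus: "\<And>t. z t \<in> torus"
      and chars: "\<And>k. \<exists>i. k i \<noteq> 0 \<Longrightarrow> \<forall>i. \<bar>k i\<bar> \<le> int N \<Longrightarrow>
        avg (\<lambda>t. \<Prod>i\<in>UNIV. z t $ i powi k i) \<longlonglongrightarrow> 0"
    for z :: "nat \<Rightarrow> complex^'n"
  proof (rule ccontr)
    assume "\<not> ?thesis"
    then have notin: "z t \<in> torus - U" for t using torus by blast
    define P where "P = (\<lambda>t. \<Prod>i\<in>UNIV. (1 + z t $ i) ^ (2 * N) * z t $ i powi (- int N) / 4 ^ N)"
    have "norm (P t) \<le> q ^ N" for t
    proof -
      have norm1: "norm (z t $ i) = 1" for i using torus by (simp add: torus_def)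
      have "norm (P t) = (\<Prod>i\<in>UNIV. (norm (1 + z t $ i))\<^sup>2 / 4) ^ N"
        by (simp add: P_def prod_norm[symmetric] norm_mult norm_divide norm_power norm_power_int
            norm1 power_mult power_divide prod_power_distrib)
      also have "\<dots> \<le> q ^ N"
        by (intro power_mono bound notin prod_nonneg) auto
      finally show ?thesis .
    qed
    then have le: "norm (avg P T) \<le> q ^ N" for T by (rule norm_avg_le)
    let ?J = "(UNIV :: 'n set) \<rightarrow> {..2 * N}"
    have fin: "finite ?J" by (simp add: finite_PiE flip: PiE_UNIV_domain)
    define a where "a = (\<lambda>j. \<Prod>i\<in>(UNIV :: 'n set). complex_of_nat (2 * N choose j i) / 4 ^ N)"
    have "avg P = (\<lambda>T. \<Sum>j\<in>?J. a j * avg (\<lambda>t. \<Prod>i\<in>UNIV. z t $ i powi (int (j i) - int N)) T)"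
      unfolding P_def Fejer_kernel_expansion[OF torus] avg_sum[abs_def] avg_cmult a_def ..
    moreover have "\<dots> \<longlonglongrightarrow> (\<Sum>j\<in>?J. a j * (if j = (\<lambda>_. N) then 1 else 0))"
    proof (intro tendsto_intros)
      fix j assume j: "j \<in> ?J"
      show "avg (\<lambda>t. \<Prod>i\<in>UNIV. z t $ i powi (int (j i) - int N)) \<longlonglongrightarrow>
        (if j = (\<lambda>_. N) then 1 else 0)"
      \<comment> \<open>Exponents are shifted by \<open>N\<close>, so the constant function
        \<open>N\<close> indexes the trivial character.\<close>
      proof (cases "j = (\<lambda>_. N)")
        case True
        then show ?thesis
          by (auto simp: avg_def eventually_sequentially intro!: tendsto_eventually exI[of _ 1])
      next
        case False
        then have "\<exists>i. int (j i) - int N \<noteq> 0" by (auto simp: fun_eq_iff)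
        moreover have "\<bar>int (j i) - int N\<bar> \<le> int N" for i
          using j by (auto simp: Pi_iff abs_le_iff dest: spec[of _ i])
        ultimately show ?thesis using False chars by auto
      qed
    qed
    ultimately have "avg P \<longlonglongrightarrow> a (\<lambda>_. N)"
      using fin by (simp add: if_distrib Pi_iff cong: if_cong)
    then have "norm (a (\<lambda>_. N)) \<le> q ^ N"
      using le by (intro LIMSEQ_le_const2[OF tendsto_norm]) auto
    also have "norm (a (\<lambda>_. N)) = c ^ CARD('n)"
      by (simp add: a_def c_def norm_power norm_divide)
    finally show False using \<open>q ^ N < c ^ CARD('n)\<close> by simp
  qed
  then show ?thesis by blast
qed

section \<open>Conjugation by transvections\<close>

definition mat_form :: "('d::finite \<Rightarrow> 'd \<Rightarrow> real) \<Rightarrow> int^'d^'d \<Rightarrow> real" where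
  "mat_form \<theta> A = (\<Sum>p\<in>UNIV. \<Sum>q\<in>UNIV. \<theta> p q * of_int (A $ p $ q))"

text \<open>The rank-one matrix \<open>c v w^T\<close>; the separate integer factor lets multiples
  and products keep this shape.\<close>

definition outer :: "int \<Rightarrow> ('d::finite \<Rightarrow> int) \<Rightarrow> ('d \<Rightarrow> int) \<Rightarrow> int^'d^'d" where
  "outer c v w = (\<chi> r s. c * v r * w s)"

lemma mat_form_add: "mat_form \<theta> (A + B) = mat_form \<theta> A + mat_form \<theta> B"
  by (simp add: mat_form_def algebra_simps sum.distrib)

lemma mat_form_diff: "mat_form \<theta> (A - B) = mat_form \<theta> A - mat_form \<theta> B"
  by (simp add: mat_form_def algebra_simps sum_subtractf)

lemma mat_form_outer: "mat_form \<theta> (outer c v w) = of_int c * pairing \<theta> v w"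
  by (simp add: mat_form_def outer_def pairing_def sum_distrib_left mult_ac)

lemma mat_form_sum:
  "mat_form (\<lambda>p q. \<Sum>i\<in>I. c i * \<theta> i p q) A = (\<Sum>i\<in>I. c i * mat_form (\<theta> i) A)"
proof -
  have "mat_form (\<lambda>p q. \<Sum>i\<in>I. c i * \<theta> i p q) A
      = (\<Sum>p\<in>UNIV. \<Sum>q\<in>UNIV. \<Sum>i\<in>I. c i * (\<theta> i p q * of_int (A $ p $ q)))"
    by (simp add: mat_form_def sum_distrib_right mult.assoc)
  also have "\<dots> = (\<Sum>p\<in>UNIV. \<Sum>i\<in>I. \<Sum>q\<in>UNIV. c i * (\<theta> i p q * of_int (A $ p $ q)))"
    by (intro sum.cong refl sum.swap)
  also have "\<dots> = (\<Sum>i\<in>I. \<Sum>p\<in>UNIV. \<Sum>q\<in>UNIV. c i * (\<theta> i p q * of_int (A $ p $ q)))"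
    by (rule sum.swap)
  finally show ?thesis by (simp add: mat_form_def sum_distrib_left)
qed

lemma outer_mult_left: "outer c v w ** A = outer c v (\<lambda>s. \<Sum>a\<in>UNIV. w a * A $ a $ s)"
  by (simp add: vec_eq_iff matrix_matrix_mult_def outer_def sum_distrib_left mult_ac)

lemma outer_mult_right: "A ** outer c v w = outer c (\<lambda>r. \<Sum>b\<in>UNIV. A $ r $ b * v b) w"
  by (simp add: vec_eq_iff matrix_matrix_mult_def outer_def sum_distrib_left sum_distrib_right mult_ac)

lemma outer_mult_outer:
  "outer c v w ** outer d v' w' = outer (c * d * (\<Sum>i\<in>UNIV. w i * v' i)) v w'"
  by (simp add: vec_eq_iff matrix_matrix_mult_def outer_def sum_distrib_left sum_distrib_right mult_ac)

lemma outer_add: "outer c v w + outer d v w = outer (c + d) v w"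
  by (simp add: vec_eq_iff outer_def algebra_simps)

lemma matrix_add_rdistrib:
  fixes A B :: "'a::semiring_1^'n^'m"
  shows "(A + B) ** C = A ** C + B ** C"
  by (simp add: vec_eq_iff matrix_matrix_mult_def distrib_right sum.distrib)

lemma matrix_diff_ldistrib:
  fixes A :: "'a::ring_1^'n^'m"
  shows "A ** (B - C) = A ** B - A ** C"
  by (simp add: vec_eq_iff matrix_matrix_mult_def right_diff_distrib sum_subtractf)

lemma matrix_diff_rdistrib:
  fixes A B :: "'a::ring_1^'n^'m"
  shows "(A - B) ** C = A ** C - B ** C"
  by (simp add: vec_eq_iff matrix_matrix_mult_def left_diff_distrib sum_subtractf)

text \<open>Orthogonality of \<open>v\<close> and \<open>w\<close> makes \<open>outer c v w\<close>
  square to zero.\<close>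

lemma transvection_inverse:
  assumes "(\<Sum>i\<in>UNIV. v i * w i) = 0"
  shows "(mat 1 + outer c v w) ** (mat 1 - outer c v w) = mat 1"
    and "(mat 1 - outer c v w) ** (mat 1 + outer c v w) = mat 1"
proof -
  have "outer c v w ** outer c v w = 0"
    using assms by (simp add: outer_mult_outer mult.commute) (simp add: outer_def vec_eq_iff)
  then show "(mat 1 + outer c v w) ** (mat 1 - outer c v w) = mat 1"
    "(mat 1 - outer c v w) ** (mat 1 + outer c v w) = mat 1"
    by (simp_all add: matrix_diff_ldistrib matrix_diff_rdistrib matrix_add_ldistrib matrix_add_rdistrib)
qed

text \<open>An even transvection is the square of an integer matrix with determinant \<open>\<plusminus>1\<close>,
  which spares the matrix determinant lemma.\<close>
lemma det_even_transvection:
  assumes "(\<Sum>i\<in>UNIV. v i * w i) = 0"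
  shows "det (mat 1 + outer (2 * c) v w) = 1"
proof -
  let ?g = "mat 1 + outer c v w"
  have "outer c v w ** outer c v w = 0"
    using assms by (simp add: outer_mult_outer mult.commute) (simp add: outer_def vec_eq_iff)
  then have "?g ** ?g = mat 1 + outer (2 * c) v w"
    by (simp add: matrix_add_ldistrib matrix_add_rdistrib outer_add add.assoc)
  then have "det (mat 1 + outer (2 * c) v w) = det ?g * det ?g" by (metis det_mul)
  moreover have "det ?g * det (mat 1 - outer c v w) = 1"
    using transvection_inverse(1)[OF assms] by (metis det_mul det_I)
  then have "\<bar>det ?g\<bar> = 1" by (metis abs_1 abs_zmult_eq_1)
  then have "det ?g * det ?g = 1" using abs_mult_self_eq[of "det ?g"] by simp
  ultimately show ?thesis by simp
qed

text \<open>With \<open>Y = outer (2 * int t) v w\<close> the conjugate is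
  \<open>C + Y C - C Y - Y C Y\<close>, and \<open>Y C Y\<close> is again a multiple of
  \<open>v w^T\<close>. Only the leading coefficient is given explicitly, since its irrationality is
  what the Weyl sum requires.\<close>

lemma mat_form_conj:
  "\<exists>\<alpha> \<beta>. \<forall>t::nat. mat_form \<theta> ((mat 1 + outer (2 * int t) v w) ** C ** (mat 1 - outer (2 * int t) v w))
    = \<alpha> + \<beta> * real t
      + (- 4 * of_int (\<Sum>b\<in>UNIV. (\<Sum>a\<in>UNIV. w a * C $ a $ b) * v b) * pairing \<theta> v w) * (real t)\<^sup>2"
proof (intro exI allI)
  fix t :: nat
  let ?Y = "outer (2 * int t) v w"
  let ?wC = "\<lambda>s. \<Sum>a\<in>UNIV. w a * C $ a $ s" and ?Cv = "\<lambda>r. \<Sum>b\<in>UNIV. C $ r $ b * v b"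
  have "(mat 1 + ?Y) ** C ** (mat 1 - ?Y) = C + ?Y ** C - C ** ?Y - (?Y ** C) ** ?Y"
    by (simp add: matrix_diff_ldistrib matrix_diff_rdistrib matrix_add_ldistrib matrix_add_rdistrib)
  also have "?Y ** C = outer (2 * int t) v ?wC" by (rule outer_mult_left)
  also have "C ** ?Y = outer (2 * int t) ?Cv w" by (rule outer_mult_right)
  also have "outer (2 * int t) v ?wC ** ?Y
      = outer (2 * int t * (2 * int t) * (\<Sum>b\<in>UNIV. ?wC b * v b)) v w"
    by (rule outer_mult_outer)
  finally have eq: "(mat 1 + ?Y) ** C ** (mat 1 - ?Y) = C + outer (2 * int t) v ?wC
      - outer (2 * int t) ?Cv w - outer (2 * int t * (2 * int t) * (\<Sum>b\<in>UNIV. ?wC b * v b)) v w" .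
  have arith: "x + 2 * s * a - 2 * s * b - 2 * s * (2 * s) * k * p
      = x + (2 * a - 2 * b) * s + (- 4 * k * p) * s\<^sup>2" for x s a b k p :: real
    by algebra
  show "mat_form \<theta> ((mat 1 + ?Y) ** C ** (mat 1 - ?Y))
    = mat_form \<theta> C + (2 * pairing \<theta> v ?wC - 2 * pairing \<theta> ?Cv w) * real t
      + (- 4 * of_int (\<Sum>b\<in>UNIV. ?wC b * v b) * pairing \<theta> v w) * (real t)\<^sup>2"
    unfolding eq mat_form_add mat_form_diff mat_form_outer of_int_mult of_int_numeral
      of_int_of_nat_eq
    by (rule arith)
qed

section \<open>Characters of trace-zero matrices\<close>

lemma int_hom_cis:
  fixes \<rho> :: "int \<Rightarrow> complex"
  assumes hom: "\<And>a b. \<rho> (a + b) = \<rho> a * \<rho> b" and norm: "\<And>a. norm (\<rho> a) = 1"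
  shows "\<exists>\<theta>::real. \<forall>a. \<rho> a = cis (2 * pi * (\<theta> * of_int a))"
proof -
  define \<theta> where "\<theta> = Arg (\<rho> 1) / (2 * pi)"
  have \<theta>: "\<rho> 1 = cis (2 * pi * \<theta>)"
    using rcis_cmod_Arg[of "\<rho> 1"] norm[of 1] by (simp add: \<theta>_def rcis_def)
  have nz: "\<rho> a \<noteq> 0" for a using norm[of a] by auto
  have "\<rho> a = cis (2 * pi * (\<theta> * of_int a))" for a
  proof (induction a rule: int_induct[of _ 0])
    case base
    show ?case using hom[of 0 0] nz[of 0] by simp
  next
    case (step1 i)
    then show ?case by (simp add: hom \<theta> cis_mult algebra_simps)
  next
    case (step2 i)
    have "\<rho> (i - 1) * \<rho> 1 = \<rho> i" using hom[of "i - 1" 1] by simp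
    then have "\<rho> (i - 1) = \<rho> i / \<rho> 1" using nz by (simp add: field_simps)
    then show ?case using step2 by (simp add: \<theta> cis_divide algebra_simps)
  qed
  then show ?thesis by blast
qed

text \<open>Composing \<open>\<phi>\<close> with a projection \<open>r\<close> of all integer
  matrices onto those of trace zero gives a character of a free group on the matrix units, which is
  determined by one angle per entry.\<close>

lemma matrix_character:
  fixes \<phi> :: "int^'d^'d \<Rightarrow> complex"
  assumes norm: "\<And>A. A \<in> trace_zero_mats \<Longrightarrow> norm (\<phi> A) = 1"
    and hom: "\<And>A B. A \<in> trace_zero_mats \<Longrightarrow> B \<in> trace_zero_mats \<Longrightarrow> \<phi> (A + B) = \<phi> A * \<phi> B"
  shows "\<exists>\<theta>. \<forall>A\<in>trace_zero_mats. \<phi> A = cis (2 * pi * mat_form \<theta> A)"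
proof -
  obtain o' :: 'd where True by blast
  define S :: "'d \<times> 'd \<Rightarrow> int \<Rightarrow> int^'d^'d"
    where "S = (\<lambda>x a. \<chi> i j. if (i, j) = x then a else 0)"
  \<comment> \<open>The trace is removed at one fixed diagonal position, which keeps
    \<open>r\<close> additive and integral.\<close>
  define r where "r = (\<lambda>A. A - S (o', o') (trace A))"
  have r_in: "r A \<in> trace_zero_mats" for A
    by (simp add: r_def S_def trace_zero_mats_def trace_def sum_subtractf)
  have r_add: "r (A + B) = r A + r B" for A B
    by (simp add: r_def S_def trace_def sum.distrib vec_eq_iff)
  have r_id: "r A = A" if "A \<in> trace_zero_mats" for A
    using that by (simp add: r_def S_def trace_zero_mats_def vec_eq_iff)
  define \<psi> where "\<psi> = (\<lambda>A. \<phi> (r A))"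
  have \<psi>_add: "\<psi> (A + B) = \<psi> A * \<psi> B" for A B by (simp add: \<psi>_def r_add hom r_in)
  have \<psi>_norm: "norm (\<psi> A) = 1" for A by (simp add: \<psi>_def norm r_in)
  have S_add: "S x (a + b) = S x a + S x b" for x a b by (simp add: S_def vec_eq_iff)
  have "\<exists>\<theta>::real. \<forall>a. \<psi> (S x a) = cis (2 * pi * (\<theta> * of_int a))" for x
    by (rule int_hom_cis) (simp_all add: S_add \<psi>_add \<psi>_norm)
  then obtain \<theta> where \<theta>: "\<And>x a. \<psi> (S x a) = cis (2 * pi * (\<theta> x * of_int a))" by metis
  have sum: "\<psi> (\<Sum>x\<in>I. S x (f x)) = cis (2 * pi * (\<Sum>x\<in>I. \<theta> x * of_int (f x)))"
    if "finite I" for I f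
    using that
  proof (induction I rule: finite_induct)
    case empty
    have "\<psi> 0 = \<psi> 0 * \<psi> 0" using \<psi>_add[of 0 0] by simp
    then show ?case using \<psi>_norm[of 0] by auto
  next
    case (insert x I)
    then show ?case by (simp add: \<psi>_add \<theta> cis_mult algebra_simps)
  qed
  have "A = (\<Sum>x\<in>UNIV. S x (A $ fst x $ snd x))" for A
    by (simp add: S_def vec_eq_iff if_distrib)
  then have "\<psi> A = cis (2 * pi * (\<Sum>x\<in>UNIV. \<theta> x * of_int (A $ fst x $ snd x)))" for A
    using sum[of UNIV "\<lambda>x. A $ fst x $ snd x"] by simp
  moreover have "(\<Sum>x\<in>UNIV. \<theta> x * of_int (A $ fst x $ snd x)) = mat_form (\<lambda>p q. \<theta> (p, q)) A" for A
    by (simp add: mat_form_def sum.cartesian_product case_prod_unfold flip: UNIV_Times_UNIV)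
  ultimately have "\<phi> A = cis (2 * pi * mat_form (\<lambda>p q. \<theta> (p, q)) A)"
    if "A \<in> trace_zero_mats" for A
    using r_id[OF that] by (metis \<psi>_def)
  then show ?thesis by blast
qed

section \<open>Dense image forces characters of infinite order\<close>

lemma common_denominator:
  fixes R :: "real set"
  assumes "finite R" "R \<subseteq> \<rat>"
  shows "\<exists>m::nat. 0 < m \<and> (\<forall>r\<in>R. real m * r \<in> \<int>)"
  using assms
proof (induction R rule: finite_induct)
  case (insert r R)
  then obtain m :: nat where m: "0 < m" "\<forall>r\<in>R. real m * r \<in> \<int>" by auto
  obtain a b :: int where ab: "0 < b" "r = of_int a / of_int b"
    using insert.prems by (auto elim: Rats_cases')
  have "real (nat b * m) * x \<in> \<int>" if "x \<in> insert r R" for x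
  proof (cases "x = r")
    case True
    have "real (nat b * m) * x = of_int (a * int m)" using ab True by simp
    then show ?thesis by (metis Ints_of_int)
  next
    case False
    then have "real m * x \<in> \<int>" using m that by auto
    then have "of_int b * (real m * x) \<in> \<int>" by (rule Ints_mult[OF Ints_of_int])
    then show ?thesis using ab by (simp add: mult_ac)
  qed
  then show ?case using ab m by (intro exI[of _ "nat b * m"]) auto
qed auto

lemma prod_cis_powi:
  "(\<Prod>i\<in>I. cis (2 * pi * x i) powi k i) = cis (2 * pi * (\<Sum>i\<in>I. of_int (k i) * x i))"
proof (induction I rule: infinite_finite_induct)
  case (insert i I)
  have "cis (2 * pi * x i) powi k i = cis (2 * pi * (of_int (k i) * x i))"
    unfolding cis_power_int by (simp only: mult.left_commute)
  then show ?case
    by (simp only: prod.insert[OF insert.hyps] sum.insert[OF insert.hyps] insert.IH cis_mult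
        distrib_left)
qed (simp_all only: prod.infinite prod.empty sum.infinite sum.empty mult_zero_right cis_zero not_False_eq_True if_False)

text \<open>A matrix that is rational modulo scalars defines a character of finite order: the scalar
  part is invisible at trace zero, and \<open>m\<close> clears the remaining denominators.\<close>

lemma mat_form_Ints:
  fixes \<theta> :: "'d::finite \<Rightarrow> 'd \<Rightarrow> real"
  assumes rat: "\<And>p q. p \<noteq> q \<Longrightarrow> \<theta> p q \<in> \<rat> \<and> \<theta> p p - \<theta> q q \<in> \<rat>"
  shows "\<exists>m::nat. 0 < m \<and> (\<forall>A\<in>trace_zero_mats. real m * mat_form \<theta> A \<in> \<int>)"
proof -
  obtain o' :: 'd where True by blast
  define \<theta>' where "\<theta>' = (\<lambda>p q. \<theta> p q - (if p = q then \<theta> o' o' else 0))"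
  have "\<theta>' p q \<in> \<rat>" for p q
    using rat[of p q] rat[of p o'] by (cases "p = o'") (auto simp: \<theta>'_def)
  then have "range (\<lambda>(p, q). \<theta>' p q) \<subseteq> \<rat>" by auto
  then obtain m :: nat where m: "0 < m" "\<And>p q. m * \<theta>' p q \<in> \<int>"
    using common_denominator[of "range (\<lambda>(p, q). \<theta>' p q)"] by auto
  have "real m * mat_form \<theta> A \<in> \<int>" if "A \<in> trace_zero_mats" for A
  proof -
    have "mat_form \<theta> A = (\<Sum>p\<in>UNIV. \<Sum>q\<in>UNIV. \<theta>' p q * of_int (A $ p $ q)
        + (if p = q then \<theta> o' o' * of_int (A $ p $ q) else 0))"
      unfolding mat_form_def by (intro sum.cong refl) (simp add: \<theta>'_def algebra_simps)
    then have "mat_form \<theta> A = mat_form \<theta>' A + \<theta> o' o' * of_int (trace A)"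
      by (simp add: mat_form_def trace_def sum.distrib sum_distrib_left)
    then have "real m * mat_form \<theta> A = (\<Sum>p\<in>UNIV. \<Sum>q\<in>UNIV. (m * \<theta>' p q) * of_int (A $ p $ q))"
      using that by (simp add: trace_zero_mats_def mat_form_def sum_distrib_left mult.assoc)
    also have "\<dots> \<in> \<int>" by (intro Ints_sum Ints_mult m) auto
    finally show ?thesis .
  qed
  with m show ?thesis by blast
qed

text \<open>Otherwise some power of the torus character with exponents \<open>k\<close> would be 1
  on the image of \<open>\<tau>\<close>, hence on its closure, the whole torus, although that
  character is nontrivial.\<close>

lemma dense_torus_hom_irrational:
  fixes \<tau> :: "int^'d^'d \<Rightarrow> complex^'n"
  assumes dense: "dense_torus_hom \<tau>"
    and \<theta>: "\<And>i A. A \<in> trace_zero_mats \<Longrightarrow> \<tau> A $ i = cis (2 * pi * mat_form (\<theta> i) A)"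
    and k: "k l \<noteq> 0"
  shows "\<exists>p q. p \<noteq> q \<and> ((\<Sum>i\<in>UNIV. of_int (k i) * \<theta> i p q) \<notin> \<rat> \<or>
    (\<Sum>i\<in>UNIV. of_int (k i) * \<theta> i p p) - (\<Sum>i\<in>UNIV. of_int (k i) * \<theta> i q q) \<notin> \<rat>)"
proof (rule ccontr)
  let ?\<Theta> = "\<lambda>p q. \<Sum>i\<in>UNIV. of_int (k i) * \<theta> i p q"
  assume "\<not> ?thesis"
  then have rat: "?\<Theta> p q \<in> \<rat> \<and> ?\<Theta> p p - ?\<Theta> q q \<in> \<rat>" if "p \<noteq> q" for p q using that by blast
  obtain m :: nat where m: "0 < m" "\<And>A. A \<in> trace_zero_mats \<Longrightarrow> real m * mat_form ?\<Theta> A \<in> \<int>"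
    using mat_form_Ints[of ?\<Theta>, OF rat] by blast
  define ch where "ch = (\<lambda>z :: complex^'n. (\<Prod>i\<in>UNIV. z $ i powi k i) ^ m)"
  have cl: "closure (\<tau> ` trace_zero_mats) = torus" using dense by (simp add: dense_torus_hom_def)
  have "ch (\<tau> A) = 1" if "A \<in> trace_zero_mats" for A
  proof -
    have "ch (\<tau> A) = cis (2 * pi * mat_form ?\<Theta> A) ^ m"
      by (simp only: ch_def \<theta>[OF that] prod_cis_powi mat_form_sum)
    also have "\<dots> = cis (2 * pi * (m * mat_form ?\<Theta> A))"
      unfolding Complex.DeMoivre by (simp only: mult.left_commute)
    finally have "ch (\<tau> A) = cis (2 * pi * (m * mat_form ?\<Theta> A))" .
    then show ?thesis using m(2)[OF that] by (simp only: cis_2pi_eq_1_iff)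
  qed
  then have "\<tau> ` trace_zero_mats \<subseteq> {z \<in> torus. ch z = 1}"
    using dense by (auto simp: dense_torus_hom_def)
  moreover have nz: "z $ i \<noteq> 0" if "z \<in> torus" for z :: "complex^'n" and i
    using that by (auto simp: torus_def dest!: spec[of _ i])
  have "closed {z \<in> torus. ch z = 1}"
  proof (rule continuous_closed_preimage_constant)
    show "continuous_on torus ch"
      unfolding ch_def
      by (intro continuous_intros) (use nz in auto)
    show "closed (torus :: (complex^'n) set)" by (metis cl closed_closure)
  qed
  ultimately have "closure (\<tau> ` trace_zero_mats) \<subseteq> {z \<in> torus. ch z = 1}"
    by (rule closure_minimal)
  then have torus: "ch z = 1" if "z \<in> torus" for z using that cl by auto
  \<comment> \<open>Only coordinate \<open>l\<close> is rotated, by the angle at which the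
    \<open>m\<close>-th power of the character equals -1.\<close>
  define x where "x = (\<lambda>i. if i = l then 1 / (2 * (real m * of_int (k l))) else 0)"
  define z :: "complex^'n" where "z = (\<chi> i. cis (2 * pi * x i))"
  have "z \<in> torus" by (simp add: z_def torus_def)
  have "ch z = cis (2 * pi * (\<Sum>i\<in>UNIV. of_int (k i) * x i)) ^ m"
    by (simp only: ch_def z_def vec_lambda_beta prod_cis_powi)
  also have "(\<Sum>i\<in>UNIV. of_int (k i) * x i) = (\<Sum>i\<in>UNIV. if i = l then 1 / (2 * real m) else 0)"
    using k by (intro sum.cong) (auto simp: x_def)
  also have "\<dots> = 1 / (2 * real m)" by simp
  also have "cis (2 * pi * (1 / (2 * real m))) ^ m = cis pi"
    unfolding Complex.DeMoivre using m by simp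
  finally show False using torus[OF \<open>z \<in> torus\<close>] by (simp add: complex_eq_iff)
qed

section \<open>Conjugates in Bohr sets\<close>

theorem mainTheorem1:
  fixes B :: "(int^'d^'d) set"
    and \<tau> :: "int^'d^'d \<Rightarrow> complex^'n"
    and U :: "(complex^'n) set"
  assumes "CARD('d) \<ge> 2"
    and "bohr_zero_witness \<tau> U B"
    and "C \<in> trace_zero_mats"
  shows "\<exists>A\<in>B. \<exists>g h :: int^'d^'d. det g = 1 \<and> g ** h = mat 1 \<and> h ** g = mat 1 \<and>
           C = h ** A ** g"
proof -
  have dense: "dense_torus_hom \<tau>" and U: "openin (top_of_set torus) U" "torus_unit \<in> U"
    and B: "B = {A \<in> trace_zero_mats. \<tau> A \<in> U}"
    using assms(2) by (auto simp: bohr_zero_witness_def)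
  have norm1: "norm (\<tau> A $ i) = 1" if "A \<in> trace_zero_mats" for A i
    using dense that by (auto simp: dense_torus_hom_def torus_def)
  have "\<exists>\<theta>. \<forall>A\<in>trace_zero_mats. \<tau> A $ i = cis (2 * pi * mat_form \<theta> A)" for i
    by (rule matrix_character) (use dense norm1 in \<open>auto simp: dense_torus_hom_def\<close>)
  then obtain \<theta> where \<theta>: "\<And>i A. A \<in> trace_zero_mats \<Longrightarrow> \<tau> A $ i = cis (2 * pi * mat_form (\<theta> i) A)"
    by metis
  show ?thesis
  proof (cases "C = 0")
    \<comment> \<open>The zero matrix is conjugate only to itself; here the unit lying in
      \<open>U\<close> is used directly.\<close>
    case True
    have "\<tau> 0 = torus_unit"
      using \<theta>[of 0] assms(3) True by (simp add: vec_eq_iff torus_unit_def mat_form_def)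
    then have "C \<in> B" using assms(3) U True by (simp add: B)
    then show ?thesis by (intro bexI[of _ C] exI[of _ "mat 1"]) auto
  next
    case False
    obtain N :: nat where N: "\<And>z :: nat \<Rightarrow> complex^'n. (\<And>t. z t \<in> torus) \<Longrightarrow>
        (\<And>k. (\<exists>i. k i \<noteq> 0) \<and> (\<forall>i. \<bar>k i\<bar> \<le> int N) \<Longrightarrow>
          avg (\<lambda>t. \<Prod>i\<in>UNIV. z t $ i powi k i) \<longlonglongrightarrow> 0) \<Longrightarrow> (\<exists>t. z t \<in> U)"
      using Bohr_recurrence[OF U] by blast
    define \<Theta> where "\<Theta> = (\<lambda>(k :: 'n \<Rightarrow> int) p q. \<Sum>i\<in>UNIV. of_int (k i) * \<theta> i p q)"
    define M where "M = {k :: 'n \<Rightarrow> int. (\<exists>i. k i \<noteq> 0) \<and> (\<forall>i. \<bar>k i\<bar> \<le> int N)}"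
    have "finite ((UNIV :: 'n set) \<rightarrow> {- int N..int N})"
      by (simp add: finite_PiE flip: PiE_UNIV_domain)
    then have "finite M"
      by (rule rev_finite_subset) (auto simp: M_def abs_le_iff minus_le_iff)
    \<comment> \<open>An irrational multiplier turns the integer condition
      \<open>w^T C v \<noteq> 0\<close> into an irrationality condition, so one application of the
      pairing lemma handles it together with all characters in \<open>M\<close>.\<close>
    obtain \<xi> :: real where \<xi>: "\<xi> \<notin> \<rat>"
      using countable_rat uncountable_UNIV_real by (metis UNIV_eq_I)
    have \<xi>_mult: "\<xi> * of_int n \<notin> \<rat>" if "n \<noteq> 0" for n :: int
    proof
      assume "\<xi> * of_int n \<in> \<rat>"
      then have "\<xi> * of_int n / of_int n \<in> \<rat>" by (intro Rats_divide) auto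
      with \<xi> that show False by simp
    qed
    \<comment> \<open>The indices are transposed so that pairing with \<open>v\<close> and
      \<open>w\<close> gives \<open>\<xi>\<close> times \<open>w^T C v\<close>.\<close>
    define \<Theta>C where "\<Theta>C = (\<lambda>p q. \<xi> * of_int (C $ q $ p))"
    \<comment> \<open>A scalar matrix of trace zero vanishes, so \<open>C \<noteq> 0\<close> cannot
      be scalar.\<close>
    have nonscalar: "\<exists>p q. p \<noteq> q \<and> (C $ q $ p \<noteq> 0 \<or> C $ p $ p - C $ q $ q \<noteq> 0)"
    proof (rule ccontr)
      assume neg: "\<not> ?thesis"
      obtain o' :: 'd where True by blast
      have diag: "C $ p $ p = C $ o' $ o'" for p using neg by (cases "p = o'") auto
      have "trace C = int CARD('d) * C $ o' $ o'"
        unfolding trace_def by (subst diag) simp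
      then have "C $ o' $ o' = 0" using assms(3) by (simp add: trace_zero_mats_def)
      then have "C = 0" using neg diag by (metis vec_eq_iff zero_index)
      with False show False by simp
    qed
    have "\<exists>v w. (\<Sum>i\<in>UNIV. v i * w i) = 0 \<and> (\<forall>\<theta>\<in>insert \<Theta>C (\<Theta> ` M). pairing \<theta> v w \<notin> \<rat>)"
    proof (rule common_irrational_pairing)
      show "\<exists>p q. p \<noteq> q \<and> (\<eta> p q \<notin> \<rat> \<or> \<eta> p p - \<eta> q q \<notin> \<rat>)" if "\<eta> \<in> insert \<Theta>C (\<Theta> ` M)" for \<eta>
      proof (cases "\<eta> = \<Theta>C")
        case True
        have "\<Theta>C p p - \<Theta>C q q = \<xi> * of_int (C $ p $ p - C $ q $ q)" for p q
          by (simp add: \<Theta>C_def algebra_simps)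
        with True nonscalar show ?thesis by (metis \<Theta>C_def \<xi>_mult)
      next
        case False
        with that obtain k l where "k l \<noteq> 0" "\<eta> = \<Theta> k" by (auto simp: M_def)
        then show ?thesis
          using dense_torus_hom_irrational[OF dense \<theta>, of k l] by (simp add: \<Theta>_def)
      qed
    qed (use \<open>finite M\<close> in simp)
    then obtain v w where vw: "(\<Sum>i\<in>UNIV. v i * w i) = 0"
      and irr: "\<And>\<eta>. \<eta> \<in> insert \<Theta>C (\<Theta> ` M) \<Longrightarrow> pairing \<eta> v w \<notin> \<rat>" by blast
    define \<kappa> where "\<kappa> = (\<Sum>b\<in>UNIV. (\<Sum>a\<in>UNIV. w a * C $ a $ b) * v b)"
    have "pairing \<Theta>C v w = \<xi> * of_int \<kappa>"
      by (simp add: pairing_def \<Theta>C_def \<kappa>_def sum_distrib_left sum_distrib_right mult_ac)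
    then have "\<kappa> \<noteq> 0" using irr[of \<Theta>C] by auto
    define g where "g = (\<lambda>t :: nat. mat 1 + outer (2 * int t) v w)"
    define h where "h = (\<lambda>t :: nat. mat 1 - outer (2 * int t) v w)"
    have gh: "g t ** h t = mat 1" "h t ** g t = mat 1" for t
      using transvection_inverse[OF vw] by (simp_all add: g_def h_def)
    have det: "det (g t) = 1" for t using det_even_transvection[OF vw] by (simp add: g_def)
    define A where "A = (\<lambda>t. g t ** C ** h t)"
    have C: "C = h t ** A t ** g t" for t
    proof -
      have "h t ** A t ** g t = (h t ** g t) ** C ** (h t ** g t)"
        by (simp only: A_def matrix_mul_assoc)
      then show ?thesis by (simp add: gh)
    qed
    have A_in: "A t \<in> trace_zero_mats" for t
    proof -
      have "trace (A t) = trace ((h t ** g t) ** C)"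
        unfolding A_def by (subst trace_mul_sym) (simp only: matrix_mul_assoc)
      then show ?thesis using assms(3) by (simp add: gh trace_zero_mats_def)
    qed
    have "\<exists>t. \<tau> (A t) \<in> U"
    proof (rule N)
      show "\<tau> (A t) \<in> torus" for t using norm1[OF A_in] by (simp add: torus_def)
      fix k :: "'n \<Rightarrow> int" assume "(\<exists>i. k i \<noteq> 0) \<and> (\<forall>i. \<bar>k i\<bar> \<le> int N)"
      then have "pairing (\<Theta> k) v w \<notin> \<rat>" by (intro irr) (simp add: M_def)
      \<comment> \<open>The leading coefficient of the phase; it is irrational because
        \<open>\<kappa>\<close> is a nonzero integer.\<close>
      define \<gamma> where "\<gamma> = - 4 * of_int \<kappa> * pairing (\<Theta> k) v w"
      have "\<gamma> \<notin> \<rat>"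
      proof
        assume "\<gamma> \<in> \<rat>"
        then have "\<gamma> / of_int (- 4 * \<kappa>) \<in> \<rat>" by (intro Rats_divide) auto
        then show False
          using \<open>pairing (\<Theta> k) v w \<notin> \<rat>\<close> \<open>\<kappa> \<noteq> 0\<close> by (simp add: \<gamma>_def)
      qed
      obtain \<alpha> \<beta> where "\<And>t. mat_form (\<Theta> k) (A t) = \<alpha> + \<beta> * real t + \<gamma> * (real t)\<^sup>2"
        using mat_form_conj[where v = v and w = w and \<theta> = "\<Theta> k" and C = C] by (auto simp: A_def g_def h_def \<gamma>_def \<kappa>_def)
      then have "(\<Prod>i\<in>UNIV. \<tau> (A t) $ i powi k i)
          = cis (2 * pi * (\<alpha> + \<beta> * real t + \<gamma> * (real t)\<^sup>2))" for t
        by (simp add: \<theta>[OF A_in] prod_cis_powi \<Theta>_def mat_form_sum)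
      then show "avg (\<lambda>t. \<Prod>i\<in>UNIV. \<tau> (A t) $ i powi k i) \<longlonglongrightarrow> 0"
        using Weyl_quadratic[OF \<open>\<gamma> \<notin> \<rat>\<close>] by simp
    qed
    then obtain t where "A t \<in> B" using A_in by (auto simp: B)
    then show ?thesis using det gh C by blast
  qed
qed

end
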